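(* Let $\mathcal{Y}$ be a nonempty convex subset of $\mathbb{R}^n$ and let $A$ be a finite set of indices. For each $i\in A$, let $\mathbf{G}_i:\mathcal{Y}\to\overline{I(\mathbb{R})}$ be a convex and $gH$-continuous interval-valued function whose $gH$-directional derivative $\mathbf{G}_{i\mathscr{D}}(\bar y;d)$ exists for all $\bar y\in\mathcal{Y}$ and all $d\in\mathcal{Y}$. Suppose that for each $y\in\mathcal{Y}$ the set $\{\mathbf{G}_i(y): i\in A\}$ is a set of comparable intervals, and define $$\mathbf{G}(y)=\max_{i\in A}\mathbf{G}_i(y),\qquad y\in\mathcal{Y}.$$ Then, for any $\bar y\in\mathcal{Y}$ and $d\in\mathcal{Y}$, $$\mathbf{G}_{\mathscr{D}}(\bar y)(d)=\max_{i\in I(\bar y)}\mathbf{G}_{i\mathscr{D}}(\bar y;d),\qquad\text{where } I(\bar y)=\{i\in A:\mathbf{G}_i(\bar y)=\mathbf{G}(\bar y)\}.$$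
   Context: $I(\mathbb{R})$ is the set of all closed bounded intervals $\mathbf{Y}=[\underline y,\overline y]$ with $\underline y\le\overline y$ real; $\mathbf{0}=[0,0]$; $\overline{I(\mathbb{R})}=I(\mathbb{R})\cup\{\boldsymbol{-\infty},\boldsymbol{+\infty}\}$. Operations: $\mathbf{Y}\oplus\mathbf{Z}=[\underline y+\underline z,\overline y+\overline z]$; for real $\delta$, $\delta\odot\mathbf{Y}=[\delta\underline y,\delta\overline y]$ if $\delta\ge0$ and $[\delta\overline y,\delta\underline y]$ if $\delta<0$; the $gH$-difference is $\mathbf{Y}\ominus_{gH}\mathbf{Z}=[\min\{\underline y-\underline z,\overline y-\overline z\},\max\{\underline y-\underline z,\overline y-\overline z\}]$. Order: $\mathbf{Z}\preceq\mathbf{Y}$ iff $\underline z\le\underline y$ and $\overline z\le\overline y$. The norm on $I(\mathbb{R})$ is $\|\mathbf{Y}\|=\max\{|\underline y|,|\overline y|\}$, and limits of intervals are taken with respect to $\|\mathbf{Y}\ominus_{gH}\mathbf{Z}\|$. A set of intervals is a set of comparable intervals if any two of its elements $\mathbf{X},\mathbf{Y}$ satisfy $\mathbf{X}\preceq\mathbf{Y}$ or $\mathbf{Y}\preceq\mathbf{X}$. For $\mathbf{Z}_1\preceq\mathbf{Z}_2\preceq\cdots\preceq\mathbf{Z}_p$, $\max\{\mathbf{Z}_1,\dots,\mathbf{Z}_p\}=\mathbf{Z}_p$. An interval-valued function $\mathbf{T}$ on a convex set $\mathcal{Y}$ is convex if $\mathbf{T}(\delta_1y_1+\delta_2y_2)\preceq\delta_1\odot\mathbf{T}(y_1)\oplus\delta_2\odot\mathbf{T}(y_2)$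 for all $y_1,y_2\in\mathcal{Y}$, $\delta_1,\delta_2\in[0,1]$, $\delta_1+\delta_2=1$. It is $gH$-continuous on $\mathcal{Y}$ if $\lim_{\|h\|\to0}(\mathbf{T}(\bar y+h)\ominus_{gH}\mathbf{T}(\bar y))=\mathbf{0}$ at each $\bar y\in\mathcal{Y}$. The $gH$-directional derivative of $\mathbf{T}$ at $\bar y\in\mathcal{Y}$ in direction $h\in\mathbb{R}^n$, denoted $\mathbf{T}_{\mathscr{D}}(\bar y)(h)$ (and $\mathbf{T}_{i\mathscr{D}}(\bar y;h)$ for an indexed function $\mathbf{T}_i$), is $\lim_{\delta\to0+}\frac1\delta\odot(\mathbf{T}(\bar y+\delta h)\ominus_{gH}\mathbf{T}(\bar y))$, provided this limit exists finitely. *)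

theory Defs
  imports "HOL-Analysis.Analysis" "HOL-Library.Interval"
begin

section \<open>Arithmetic of closed bounded intervals\<close>

text \<open>
  Closed bounded real intervals are the library type \<^typ>\<open>real interval\<close>; its addition is the
  endpointwise sum and its \<open>0\<close> is \<open>[0,0]\<close>. The library's \<open>-\<close> and \<open>\<le>\<close> on intervals are the
  Minkowski difference and set inclusion; neither is used below.
\<close>

definition ivl_scale :: "real \<Rightarrow> real interval \<Rightarrow> real interval"  (infixr \<open>\<odot>\<close> 75)
  where "\<delta> \<odot> Y = (if \<delta> \<ge> 0 then Interval (\<delta> * lower Y, \<delta> * upper Y)
                          else Interval (\<delta> * upper Y, \<delta> * lower Y))"

definition gH_diff :: "real interval \<Rightarrow> real interval \<Rightarrow> real interval"  (infixl \<open>\<ominus>\<^sub>g\<^sub>H\<close> 65)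
  where "Y \<ominus>\<^sub>g\<^sub>H Z = Interval (min (lower Y - lower Z) (upper Y - upper Z),
                             max (lower Y - lower Z) (upper Y - upper Z))"

lemma bounds_Interval:
  assumes "a \<le> b"
  shows "lower (Interval (a, b)) = a" "upper (Interval (a, b)) = b"
  using assms by (simp_all add: lower.rep_eq upper.rep_eq Interval_inverse)

lemma bounds_ivl_scale:
  "lower (\<delta> \<odot> Y) = (if \<delta> \<ge> 0 then \<delta> * lower Y else \<delta> * upper Y)"
  "upper (\<delta> \<odot> Y) = (if \<delta> \<ge> 0 then \<delta> * upper Y else \<delta> * lower Y)"
  by (auto simp: ivl_scale_def bounds_Interval mult_left_mono mult_left_mono_neg)

lemma bounds_gH_diff:
  "lower (Y \<ominus>\<^sub>g\<^sub>H Z) = min (lower Y - lower Z) (upper Y - upper Z)"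
  "upper (Y \<ominus>\<^sub>g\<^sub>H Z) = max (lower Y - lower Z) (upper Y - upper Z)"
  by (auto simp: gH_diff_def bounds_Interval)

definition ivl_norm :: "real interval \<Rightarrow> real"
  where "ivl_norm X = max \<bar>lower X\<bar> \<bar>upper X\<bar>"

definition ivl_tendsto :: "('b \<Rightarrow> real interval) \<Rightarrow> real interval \<Rightarrow> 'b filter \<Rightarrow> bool"
  where "ivl_tendsto f L F \<longleftrightarrow> ((\<lambda>x. ivl_norm (f x \<ominus>\<^sub>g\<^sub>H L)) \<longlongrightarrow> 0) F"


section \<open>Extended intervals\<close>

datatype ext_ivl = MInf | is_Fin: Fin (fin: "real interval") | PInf

definition ext_le :: "ext_ivl \<Rightarrow> ext_ivl \<Rightarrow> bool"  (infix \<open>\<preceq>\<close> 50)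
  where "Z \<preceq> Y \<longleftrightarrow> Z = MInf \<or> Y = PInf \<or>
    (\<exists>z y. Z = Fin z \<and> Y = Fin y \<and> lower z \<le> lower y \<and> upper z \<le> upper y)"

text \<open>
  Conventions at infinity, used only to make convexity meaningful for extended values:
  \<open>(+\<infinity>) + (-\<infinity>) = +\<infinity>\<close> and \<open>0 \<cdot> (\<plusminus>\<infinity>) = 0\<close>. They have no influence on gH-continuous functions,
  whose values are finite.
\<close>

fun ext_add :: "ext_ivl \<Rightarrow> ext_ivl \<Rightarrow> ext_ivl"
  where
    "ext_add (Fin a) (Fin b) = Fin (a + b)"
  | "ext_add PInf _ = PInf"
  | "ext_add _ PInf = PInf"
  | "ext_add _ _ = MInf"

fun ext_scale :: "real \<Rightarrow> ext_ivl \<Rightarrow> ext_ivl"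
  where
    "ext_scale \<delta> (Fin a) = Fin (\<delta> \<odot> a)"
  | "ext_scale \<delta> PInf = (if \<delta> = 0 then Fin 0 else if \<delta> > 0 then PInf else MInf)"
  | "ext_scale \<delta> MInf = (if \<delta> = 0 then Fin 0 else if \<delta> > 0 then MInf else PInf)"

definition comparable_ivls :: "ext_ivl set \<Rightarrow> bool"
  where "comparable_ivls S \<longleftrightarrow> (\<forall>X\<in>S. \<forall>Y\<in>S. X \<preceq> Y \<or> Y \<preceq> X)"

text \<open>Meaningful for finite nonempty sets of comparable intervals.\<close>

definition ivl_max :: "ext_ivl set \<Rightarrow> ext_ivl"
  where "ivl_max S = (THE M. M \<in> S \<and> (\<forall>X\<in>S. X \<preceq> M))"


section \<open>Interval-valued functions on a set\<close>

text \<open>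
  A function \<open>T\<close> on \<open>S\<close> with extended interval values is a total function of which only the values
  on \<open>S\<close> are used.
\<close>

definition ivf_convex_on :: "'a::real_vector set \<Rightarrow> ('a \<Rightarrow> ext_ivl) \<Rightarrow> bool"
  where "ivf_convex_on S T \<longleftrightarrow>
    (\<forall>y1\<in>S. \<forall>y2\<in>S. \<forall>\<delta>1\<in>{0..1}. \<forall>\<delta>2\<in>{0..1}. \<delta>1 + \<delta>2 = 1 \<longrightarrow>
      T (\<delta>1 *\<^sub>R y1 + \<delta>2 *\<^sub>R y2) \<preceq> ext_add (ext_scale \<delta>1 (T y1)) (ext_scale \<delta>2 (T y2)))"

text \<open>
  The gH-difference is only defined for finite intervals, so the limits below presuppose finite
  values. In the continuity limit \<open>h\<close> ranges over the increments with \<open>y + h \<in> S\<close>.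
\<close>

definition gH_continuous_on :: "'a::real_normed_vector set \<Rightarrow> ('a \<Rightarrow> ext_ivl) \<Rightarrow> bool"
  where "gH_continuous_on S T \<longleftrightarrow>
    (\<forall>y\<in>S. is_Fin (T y)) \<and>
    (\<forall>y\<in>S. ivl_tendsto (\<lambda>h. fin (T (y + h)) \<ominus>\<^sub>g\<^sub>H fin (T y)) 0 (at 0 within {h. y + h \<in> S}))"

text \<open>
  As \<open>T\<close> is given on \<open>S\<close> only, existence of the one-sided limit includes that the difference
  quotient is defined, that is \<open>y + \<delta> h \<in> S\<close> with finite value there, for all small \<open>\<delta> > 0\<close>.
\<close>

definition has_gH_dir_deriv ::
    "'a::real_vector set \<Rightarrow> ('a \<Rightarrow> ext_ivl) \<Rightarrow> 'a \<Rightarrow> 'a \<Rightarrow> real interval \<Rightarrow> bool"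
  where "has_gH_dir_deriv S T y h L \<longleftrightarrow>
    y \<in> S \<and> is_Fin (T y) \<and>
    (\<forall>\<^sub>F \<delta> in at_right 0. y + \<delta> *\<^sub>R h \<in> S \<and> is_Fin (T (y + \<delta> *\<^sub>R h))) \<and>
    ivl_tendsto (\<lambda>\<delta>. (1 / \<delta>) \<odot> (fin (T (y + \<delta> *\<^sub>R h)) \<ominus>\<^sub>g\<^sub>H fin (T y))) L (at_right (0::real))"

definition gH_dir_differentiable ::
    "'a::real_vector set \<Rightarrow> ('a \<Rightarrow> ext_ivl) \<Rightarrow> 'a \<Rightarrow> 'a \<Rightarrow> bool"
  where "gH_dir_differentiable S T y h \<longleftrightarrow> (\<exists>L. has_gH_dir_deriv S T y h L)"

definition gH_dir_deriv ::
    "'a::real_vector set \<Rightarrow> ('a \<Rightarrow> ext_ivl) \<Rightarrow> 'a \<Rightarrow> 'a \<Rightarrow> real interval"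
  where "gH_dir_deriv S T y h = (THE L. has_gH_dir_deriv S T y h L)"

end

theory Submission
  imports Defs
begin

text \<open>
  For fixed \<open>\<delta> > 0\<close> and a fixed interval \<open>Z\<close>, the quotient \<open>X \<mapsto> (1 / \<delta>) \<odot> (X \<ominus>\<^sub>g\<^sub>H Z)\<close> is monotone for
  the endpointwise order. If all the functions take the same value \<open>Z\<close> at the base point, a maximum
  over a chain therefore passes through the difference quotient: the quotient of the maximum
  dominates the quotients of all members and coincides with one of them. Two facts turn this into
  the formula for the derivative.

  First, only the members active at the base point matter (\<open>eventually_max_is_active\<close>): at the base
  point a non-active member is strictly below the maximum in at least one endpoint, and as the
  existence of the directional derivative forces continuity along the ray
  (\<open>has_gH_dir_deriv_imp_tendsto\<close>), this strict inequality persists near the base point.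
  Comparability then forbids the non-active member from overtaking an active one, whatever the other
  endpoint does.

  Secondly, the derivatives of the active members again form a chain
  (\<open>comparable_limits\<close>): of the two possible orders of two members, one occurs for arbitrarily small
  \<open>\<delta>\<close> and survives in the limit. As the index set is finite, the quotient of the maximum is then
  squeezed to the largest of the limits (\<open>ivl_tendsto_chain_max\<close>).
\<close>


section \<open>The order on extended intervals\<close>

lemma ext_le_Fin [simp]:
  "Fin a \<preceq> Fin b \<longleftrightarrow> lower a \<le> lower b \<and> upper a \<le> upper b"
  by (simp add: ext_le_def)

lemma ext_le_trans: "X \<preceq> Y \<Longrightarrow> Y \<preceq> Z \<Longrightarrow> X \<preceq> Z"
  by (force simp: ext_le_def)

lemma ext_le_antisym: "X \<preceq> Y \<Longrightarrow> Y \<preceq> X \<Longrightarrow> X = Y"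
  by (auto simp: ext_le_def interval_eq_iff)

lemma ivl_max_eqI:
  assumes "M \<in> S" and "\<And>X. X \<in> S \<Longrightarrow> X \<preceq> M"
  shows "ivl_max S = M"
  unfolding ivl_max_def using assms by (blast intro: ext_le_antisym)

lemma finite_chain_has_max:
  assumes "finite S" and "S \<noteq> {}" and "comparable_ivls S"
  shows "\<exists>M\<in>S. \<forall>X\<in>S. X \<preceq> M"
  using assms
proof (induction S rule: finite_ne_induct)
  case (singleton x)
  then show ?case by (auto simp: comparable_ivls_def)
next
  case (insert x S)
  then obtain M where M: "M \<in> S" "\<forall>X\<in>S. X \<preceq> M"
    by (auto simp: comparable_ivls_def)
  have "x \<preceq> x" and "x \<preceq> M \<or> M \<preceq> x"
    using insert.prems M(1) by (auto simp: comparable_ivls_def)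
  then show ?case
    using M ext_le_trans by (metis insert_iff)
qed

lemma
  assumes "finite S" and "S \<noteq> {}" and "comparable_ivls S"
  shows ivl_max_in: "ivl_max S \<in> S"
    and ivl_max_upper: "X \<in> S \<Longrightarrow> X \<preceq> ivl_max S"
proof -
  obtain M where M: "M \<in> S" "\<forall>X\<in>S. X \<preceq> M"
    using finite_chain_has_max [OF assms] by blast
  then have "ivl_max S = M" by (intro ivl_max_eqI) auto
  with M show "ivl_max S \<in> S" and "X \<in> S \<Longrightarrow> X \<preceq> ivl_max S" by auto
qed


section \<open>Limits of intervals\<close>

text \<open>
  The gH-difference sorts the two endpoint differences, but the norm takes the larger absolute value
  and so does not see their order. Interval limits thus reduce to limits of real functions.
\<close>

lemma ivl_tendsto_iff:
  "ivl_tendsto f L F \<longleftrightarrow>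
    ((\<lambda>x. lower (f x)) \<longlongrightarrow> lower L) F \<and> ((\<lambda>x. upper (f x)) \<longlongrightarrow> upper L) F"
proof -
  have norm: "ivl_norm (X \<ominus>\<^sub>g\<^sub>H L) = max \<bar>lower X - lower L\<bar> \<bar>upper X - upper L\<bar>" for X
    by (auto simp: ivl_norm_def bounds_gH_diff)
  have max_zero: "((\<lambda>x. max \<bar>a x\<bar> \<bar>b x\<bar>) \<longlongrightarrow> 0) F \<longleftrightarrow> (a \<longlongrightarrow> 0) F \<and> (b \<longlongrightarrow> 0) F"
    for a b :: "_ \<Rightarrow> real"
  proof (intro iffI conjI)
    assume m: "((\<lambda>x. max \<bar>a x\<bar> \<bar>b x\<bar>) \<longlongrightarrow> 0) F"
    show "(a \<longlongrightarrow> 0) F" "(b \<longlongrightarrow> 0) F"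
      by (rule Lim_null_comparison [OF _ m], simp)+
  next
    assume "(a \<longlongrightarrow> 0) F \<and> (b \<longlongrightarrow> 0) F"
    then have "((\<lambda>x. max \<bar>a x\<bar> \<bar>b x\<bar>) \<longlongrightarrow> max \<bar>0\<bar> \<bar>0\<bar>) F"
      by (intro tendsto_max tendsto_rabs) auto
    then show "((\<lambda>x. max \<bar>a x\<bar> \<bar>b x\<bar>) \<longlongrightarrow> 0) F" by simp
  qed
  show ?thesis
    unfolding ivl_tendsto_def norm max_zero by (simp only: LIM_zero_iff)
qed

lemma ivl_tendsto_unique:
  assumes "F \<noteq> bot" and "ivl_tendsto f L F" and "ivl_tendsto f M F"
  shows "L = M"
  using assms tendsto_unique by (auto simp: ivl_tendsto_iff interval_eq_iff)

text \<open>
  Comparability of the values need not hold in the same direction throughout, so the order of the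
  limits is found by cases: unless \<open>f \<preceq> g\<close> holds eventually, the points where it fails meet every
  set of \<open>F\<close>, so that \<open>F\<close> restricted to them is a proper filter. There \<open>g \<preceq> f\<close> holds and limits
  may be taken.
\<close>

lemma comparable_limits:
  assumes f: "ivl_tendsto f L F" and g: "ivl_tendsto g M F" and "F \<noteq> bot"
    and cmp: "\<forall>\<^sub>F x in F. Fin (f x) \<preceq> Fin (g x) \<or> Fin (g x) \<preceq> Fin (f x)"
  shows "Fin L \<preceq> Fin M \<or> Fin M \<preceq> Fin L"
proof -
  have le: "Fin L' \<preceq> Fin M'"
    if f': "ivl_tendsto f' L' F'" and g': "ivl_tendsto g' M' F'" and nt: "F' \<noteq> bot"
      and ev: "\<forall>\<^sub>F x in F'. Fin (f' x) \<preceq> Fin (g' x)" for f' g' L' M' F'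
  proof -
    have "lower L' \<le> lower M'"
      by (rule tendsto_le [OF nt, of "\<lambda>x. lower (g' x)" _ "\<lambda>x. lower (f' x)"])
        (use f' g' ev in \<open>auto simp: ivl_tendsto_iff elim: eventually_mono\<close>)
    moreover have "upper L' \<le> upper M'"
      by (rule tendsto_le [OF nt, of "\<lambda>x. upper (g' x)" _ "\<lambda>x. upper (f' x)"])
        (use f' g' ev in \<open>auto simp: ivl_tendsto_iff elim: eventually_mono\<close>)
    ultimately show ?thesis by simp
  qed
  show ?thesis
  proof (cases "\<forall>\<^sub>F x in F. Fin (f x) \<preceq> Fin (g x)")
    case True
    then show ?thesis using le [OF f g \<open>F \<noteq> bot\<close>] by blast
  next
    case False
    define F' where "F' = inf F (principal {x. \<not> Fin (f x) \<preceq> Fin (g x)})"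
    have "F' \<noteq> bot"
      using False by (simp add: F'_def trivial_limit_def eventually_inf_principal del: ext_le_Fin)
    moreover have "F' \<le> F" by (simp add: F'_def)
    then have "ivl_tendsto f L F'" "ivl_tendsto g M F'"
      using f g by (auto simp: ivl_tendsto_iff intro: tendsto_mono)
    moreover have "\<forall>\<^sub>F x in F'. Fin (g x) \<preceq> Fin (f x)"
      unfolding F'_def eventually_inf_principal using cmp by eventually_elim blast
    ultimately show ?thesis using le by blast
  qed
qed

text \<open>
  The index of the member that \<open>w\<close> follows may jump forever as \<open>x\<close> varies. From above, \<open>w\<close> is
  controlled uniformly over the finitely many members, all of whose limits are at most \<open>l j\<close>; from
  below it is controlled by the single member \<open>j\<close>.
\<close>

lemma tendsto_chain_max:
  fixes u :: "'i \<Rightarrow> 'b \<Rightarrow> 'c::linorder_topology"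
  assumes "finite I" and "\<And>i. i \<in> I \<Longrightarrow> (u i \<longlongrightarrow> l i) F" and "j \<in> I"
    and "\<And>i. i \<in> I \<Longrightarrow> l i \<le> l j"
    and w: "\<forall>\<^sub>F x in F. (\<exists>i\<in>I. w x = u i x) \<and> u j x \<le> w x"
  shows "(w \<longlongrightarrow> l j) F"
proof (rule order_tendstoI)
  fix a assume "a < l j"
  then have "\<forall>\<^sub>F x in F. a < u j x"
    using assms(2,3) order_tendstoD(1) by blast
  with w show "\<forall>\<^sub>F x in F. a < w x"
    by eventually_elim auto
next
  fix a assume "l j < a"
  then have "\<forall>\<^sub>F x in F. u i x < a" if "i \<in> I" for i
    using assms(2,4) that order_tendstoD(2) le_less_trans by blast
  then have "\<forall>\<^sub>F x in F. \<forall>i\<in>I. u i x < a"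
    using \<open>finite I\<close> by (simp add: eventually_ball_finite)
  with w show "\<forall>\<^sub>F x in F. w x < a"
    by eventually_elim auto
qed

lemma ivl_tendsto_chain_max:
  assumes "finite I" and lim: "\<And>i. i \<in> I \<Longrightarrow> ivl_tendsto (u i) (l i) F" and "j \<in> I"
    and le: "\<And>i. i \<in> I \<Longrightarrow> Fin (l i) \<preceq> Fin (l j)"
    and w: "\<forall>\<^sub>F x in F. (\<exists>i\<in>I. w x = u i x) \<and> Fin (u j x) \<preceq> Fin (w x)"
  shows "ivl_tendsto w (l j) F"
proof -
  have "((\<lambda>x. lower (w x)) \<longlongrightarrow> lower (l j)) F"
    by (rule tendsto_chain_max [of I "\<lambda>i x. lower (u i x)" "\<lambda>i. lower (l i)"])
      (use assms in \<open>auto simp: ivl_tendsto_iff elim!: eventually_mono\<close>)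
  moreover have "((\<lambda>x. upper (w x)) \<longlongrightarrow> upper (l j)) F"
    by (rule tendsto_chain_max [of I "\<lambda>i x. upper (u i x)" "\<lambda>i. upper (l i)"])
      (use assms in \<open>auto simp: ivl_tendsto_iff elim!: eventually_mono\<close>)
  ultimately show ?thesis by (simp add: ivl_tendsto_iff)
qed

lemma eventually_less_of_limits:
  fixes f g :: "'b \<Rightarrow> real"
  assumes "(f \<longlongrightarrow> a) F" and "(g \<longlongrightarrow> b) F" and "a < b"
  shows "\<forall>\<^sub>F x in F. f x < g x"
proof -
  obtain c where "a < c" "c < b" using dense [OF \<open>a < b\<close>] by blast
  with order_tendstoD assms(1,2) have "\<forall>\<^sub>F x in F. f x < c" "\<forall>\<^sub>F x in F. c < g x"
    by blast+
  then show ?thesis by eventually_elim simp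
qed


section \<open>Difference quotients and directional derivatives\<close>

lemma gH_quotient_mono:
  assumes "X \<preceq> Y" and "is_Fin X" and "is_Fin Y" and "\<delta> > 0"
  shows "Fin ((1 / \<delta>) \<odot> (fin X \<ominus>\<^sub>g\<^sub>H Z)) \<preceq> Fin ((1 / \<delta>) \<odot> (fin Y \<ominus>\<^sub>g\<^sub>H Z))"
  using assms by (cases X; cases Y)
    (auto simp: bounds_ivl_scale bounds_gH_diff intro!: divide_right_mono)

lemma has_gH_dir_deriv_unique:
  assumes "has_gH_dir_deriv S T y h L" and "has_gH_dir_deriv S T y h M"
  shows "L = M"
proof -
  let ?q = "\<lambda>\<delta>. (1 / \<delta>) \<odot> (fin (T (y + \<delta> *\<^sub>R h)) \<ominus>\<^sub>g\<^sub>H fin (T y))"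
  have "ivl_tendsto ?q L (at_right 0)" "ivl_tendsto ?q M (at_right 0)"
    using assms by (simp_all add: has_gH_dir_deriv_def)
  then show ?thesis
    by (rule ivl_tendsto_unique [OF trivial_limit_at_right_real])
qed

lemma gH_dir_deriv_eqI:
  assumes "has_gH_dir_deriv S T y h L"
  shows "gH_dir_deriv S T y h = L"
  unfolding gH_dir_deriv_def using assms has_gH_dir_deriv_unique by blast

lemma has_gH_dir_deriv_gH_dir_deriv:
  assumes "gH_dir_differentiable S T y h"
  shows "has_gH_dir_deriv S T y h (gH_dir_deriv S T y h)"
proof -
  obtain L where "has_gH_dir_deriv S T y h L"
    using assms by (auto simp: gH_dir_differentiable_def)
  with gH_dir_deriv_eqI [OF this] show ?thesis by simp
qed

text \<open>
  A convergent difference quotient multiplied by \<open>\<delta>\<close> tends to \<open>0\<close>. The quotient only carries the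
  minimum and the maximum of the two endpoint increments, but as both tend to \<open>0\<close>, so does each
  increment.
\<close>

lemma has_gH_dir_deriv_imp_tendsto:
  assumes "has_gH_dir_deriv S T y h L"
  shows "ivl_tendsto (\<lambda>\<delta>. fin (T (y + \<delta> *\<^sub>R h))) (fin (T y)) (at_right (0::real))"
proof -
  define a where "a \<delta> = lower (fin (T (y + \<delta> *\<^sub>R h))) - lower (fin (T y))" for \<delta> :: real
  define b where "b \<delta> = upper (fin (T (y + \<delta> *\<^sub>R h))) - upper (fin (T y))" for \<delta> :: real
  let ?q = "\<lambda>\<delta>. (1 / \<delta>) \<odot> (fin (T (y + \<delta> *\<^sub>R h)) \<ominus>\<^sub>g\<^sub>H fin (T y))"
  have pos: "\<forall>\<^sub>F \<delta> in at_right 0. 0 < (\<delta>::real)"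
    by (rule eventually_at_right_less)
  have q: "((\<lambda>\<delta>. lower (?q \<delta>)) \<longlongrightarrow> lower L) (at_right 0)"
    "((\<lambda>\<delta>. upper (?q \<delta>)) \<longlongrightarrow> upper L) (at_right 0)"
    using assms by (auto simp: has_gH_dir_deriv_def ivl_tendsto_iff)
  have "((\<lambda>\<delta>. \<delta> * lower (?q \<delta>)) \<longlongrightarrow> 0 * lower L) (at_right 0)"
    by (intro tendsto_mult q tendsto_ident_at)
  moreover have "\<forall>\<^sub>F \<delta> in at_right 0. \<delta> * lower (?q \<delta>) = min (a \<delta>) (b \<delta>)"
    using pos by eventually_elim (simp add: bounds_ivl_scale bounds_gH_diff a_def b_def)
  ultimately have mn: "((\<lambda>\<delta>. min (a \<delta>) (b \<delta>)) \<longlongrightarrow> 0) (at_right 0)"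
    by (simp add: tendsto_cong)
  have "((\<lambda>\<delta>. \<delta> * upper (?q \<delta>)) \<longlongrightarrow> 0 * upper L) (at_right 0)"
    by (intro tendsto_mult q tendsto_ident_at)
  moreover have "\<forall>\<^sub>F \<delta> in at_right 0. \<delta> * upper (?q \<delta>) = max (a \<delta>) (b \<delta>)"
    using pos by eventually_elim (simp add: bounds_ivl_scale bounds_gH_diff a_def b_def)
  ultimately have mx: "((\<lambda>\<delta>. max (a \<delta>) (b \<delta>)) \<longlongrightarrow> 0) (at_right 0)"
    by (simp add: tendsto_cong)
  have "(a \<longlongrightarrow> 0) (at_right 0)" "(b \<longlongrightarrow> 0) (at_right 0)"
    by (rule tendsto_sandwich [OF _ _ mn mx]; simp)+
  then show ?thesis
    unfolding ivl_tendsto_iff a_def b_def by (simp only: LIM_zero_iff)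
qed


section \<open>Maxima of finitely many comparable functions\<close>

locale comparable_family =
  fixes S :: "'a::real_vector set" and A :: "'i set" and G :: "'i \<Rightarrow> 'a \<Rightarrow> ext_ivl"
    and Gmax :: "'a \<Rightarrow> ext_ivl" and y h :: 'a
  assumes finite_index: "finite A" and nonempty_index: "A \<noteq> {}"
    and comparable: "\<And>x. x \<in> S \<Longrightarrow> comparable_ivls {G i x | i. i \<in> A}"
    and Gmax_eq: "\<And>x. x \<in> S \<Longrightarrow> Gmax x = ivl_max {G i x | i. i \<in> A}"
    and differentiable: "\<And>i. i \<in> A \<Longrightarrow> gH_dir_differentiable S (G i) y h"
begin

definition active :: "'i set"
  where "active = {i \<in> A. G i y = Gmax y}"

abbreviation D :: "'i \<Rightarrow> real interval"
  where "D i \<equiv> gH_dir_deriv S (G i) y h"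

abbreviation quotient :: "('a \<Rightarrow> ext_ivl) \<Rightarrow> real \<Rightarrow> real interval"
  where "quotient T \<delta> \<equiv> (1 / \<delta>) \<odot> (fin (T (y + \<delta> *\<^sub>R h)) \<ominus>\<^sub>g\<^sub>H fin (T y))"

lemma has_deriv: "i \<in> A \<Longrightarrow> has_gH_dir_deriv S (G i) y h (D i)"
  by (simp add: differentiable has_gH_dir_deriv_gH_dir_deriv)

lemma base_in: "y \<in> S"
  using nonempty_index has_deriv by (auto simp: has_gH_dir_deriv_def)

lemma base_finite: "i \<in> A \<Longrightarrow> is_Fin (G i y)"
  using has_deriv by (auto simp: has_gH_dir_deriv_def)

lemma eventually_on_ray:
  "\<forall>\<^sub>F \<delta> in at_right 0. 0 < \<delta> \<and> y + \<delta> *\<^sub>R h \<in> S \<and> (\<forall>i\<in>A. is_Fin (G i (y + \<delta> *\<^sub>R h)))"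
proof -
  have "\<forall>\<^sub>F \<delta> in at_right 0. \<forall>i\<in>A. y + \<delta> *\<^sub>R h \<in> S \<and> is_Fin (G i (y + \<delta> *\<^sub>R h))"
    using has_deriv finite_index by (auto simp: has_gH_dir_deriv_def eventually_ball_finite)
  moreover have "\<forall>\<^sub>F \<delta> in at_right 0. 0 < (\<delta>::real)"
    by (rule eventually_at_right_less)
  ultimately show ?thesis
    by eventually_elim (use nonempty_index in auto)
qed

lemma Gmax_attained: "x \<in> S \<Longrightarrow> \<exists>i\<in>A. Gmax x = G i x"
  using ivl_max_in [of "{G i x | i. i \<in> A}"] finite_index nonempty_index comparable Gmax_eq by auto

lemma Gmax_upper: "x \<in> S \<Longrightarrow> i \<in> A \<Longrightarrow> G i x \<preceq> Gmax x"
  using ivl_max_upper [of "{G i x | i. i \<in> A}"] finite_index nonempty_index comparable Gmax_eq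
  by auto

lemma G_comparable: "x \<in> S \<Longrightarrow> i \<in> A \<Longrightarrow> k \<in> A \<Longrightarrow> G i x \<preceq> G k x \<or> G k x \<preceq> G i x"
  using comparable by (auto simp: comparable_ivls_def)

lemma active_subset: "active \<subseteq> A" and finite_active: "finite active"
  using finite_index by (auto simp: active_def)

lemma active_nonempty: "active \<noteq> {}"
  using Gmax_attained [OF base_in] by (auto simp: active_def)

text \<open>
  A single strict endpoint inequality at the base point is enough: it persists by continuity and
  excludes the wrong one of the two alternatives of comparability.
\<close>

lemma eventually_inactive_le:
  assumes i: "i \<in> A" "i \<notin> active" and j: "j \<in> active"
  shows "\<forall>\<^sub>F \<delta> in at_right 0. G i (y + \<delta> *\<^sub>R h) \<preceq> G j (y + \<delta> *\<^sub>R h)"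
proof -
  have "j \<in> A" using j active_subset by auto
  let ?f = "\<lambda>k \<delta>. fin (G k (y + \<delta> *\<^sub>R h))"
  have lim: "ivl_tendsto (?f k) (fin (G k y)) (at_right 0)" if "k \<in> A" for k
    using that has_deriv has_gH_dir_deriv_imp_tendsto by blast
  have fin: "G i y = Fin (fin (G i y))" "G j y = Fin (fin (G j y))"
    using base_finite i \<open>j \<in> A\<close> by simp_all
  have "G i y \<preceq> G j y" "G i y \<noteq> G j y"
    using i j Gmax_upper [OF base_in] by (auto simp: active_def)
  then have "\<not> G j y \<preceq> G i y"
    using ext_le_antisym by blast
  then have "lower (fin (G i y)) < lower (fin (G j y)) \<or> upper (fin (G i y)) < upper (fin (G j y))"
    using fin ext_le_Fin by (metis not_le)
  then have "\<forall>\<^sub>F \<delta> in at_right 0. lower (?f i \<delta>) < lower (?f j \<delta>) \<or> upper (?f i \<delta>) < upper (?f j \<delta>)"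
  proof
    assume "lower (fin (G i y)) < lower (fin (G j y))"
    then have "\<forall>\<^sub>F \<delta> in at_right 0. lower (?f i \<delta>) < lower (?f j \<delta>)"
      using lim [OF i(1)] lim [OF \<open>j \<in> A\<close>]
      by (intro eventually_less_of_limits [where F = "at_right 0"]) (simp_all add: ivl_tendsto_iff)
    then show ?thesis by eventually_elim simp
  next
    assume "upper (fin (G i y)) < upper (fin (G j y))"
    then have "\<forall>\<^sub>F \<delta> in at_right 0. upper (?f i \<delta>) < upper (?f j \<delta>)"
      using lim [OF i(1)] lim [OF \<open>j \<in> A\<close>]
      by (intro eventually_less_of_limits [where F = "at_right 0"]) (simp_all add: ivl_tendsto_iff)
    then show ?thesis by eventually_elim simp
  qed
  with eventually_on_ray show ?thesis
  proof eventually_elim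
    case (elim \<delta>)
    then have "\<not> G j (y + \<delta> *\<^sub>R h) \<preceq> G i (y + \<delta> *\<^sub>R h)"
      using i(1) \<open>j \<in> A\<close> ext_le_Fin ext_ivl.collapse by (metis not_le)
    then show ?case
      using G_comparable elim i(1) \<open>j \<in> A\<close> by blast
  qed
qed

lemma eventually_max_is_active:
  "\<forall>\<^sub>F \<delta> in at_right 0. \<exists>i\<in>active. Gmax (y + \<delta> *\<^sub>R h) = G i (y + \<delta> *\<^sub>R h)"
proof -
  obtain j where j: "j \<in> active" using active_nonempty by auto
  then have "j \<in> A" using active_subset by auto
  have "\<forall>\<^sub>F \<delta> in at_right 0. \<forall>i\<in>A - active. G i (y + \<delta> *\<^sub>R h) \<preceq> G j (y + \<delta> *\<^sub>R h)"
    using eventually_inactive_le j finite_index by (simp add: eventually_ball_finite)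
  with eventually_on_ray show ?thesis
  proof eventually_elim
    case (elim \<delta>)
    then obtain k where k: "k \<in> A" "Gmax (y + \<delta> *\<^sub>R h) = G k (y + \<delta> *\<^sub>R h)"
      using Gmax_attained by blast
    show ?case
    proof (cases "k \<in> active")
      case False
      with elim k have "Gmax (y + \<delta> *\<^sub>R h) \<preceq> G j (y + \<delta> *\<^sub>R h)" by simp
      moreover have "G j (y + \<delta> *\<^sub>R h) \<preceq> Gmax (y + \<delta> *\<^sub>R h)"
        using Gmax_upper elim \<open>j \<in> A\<close> by blast
      ultimately show ?thesis using j ext_le_antisym by blast
    qed (use k in blast)
  qed
qed

lemma quotient_tendsto: "i \<in> A \<Longrightarrow> ivl_tendsto (quotient (G i)) (D i) (at_right 0)"
  using has_deriv by (auto simp: has_gH_dir_deriv_def)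

text \<open>
  Active members share their value at the base point, so their quotients are ordered like their
  values further along the ray.
\<close>

lemma active_derivs_comparable: "comparable_ivls {Fin (D i) | i. i \<in> active}"
proof -
  have "Fin (D i) \<preceq> Fin (D k) \<or> Fin (D k) \<preceq> Fin (D i)" if "i \<in> active" "k \<in> active" for i k
  proof (rule comparable_limits)
    have in_A: "i \<in> A" "k \<in> A" and base: "G i y = G k y"
      using that by (auto simp: active_def)
    show "ivl_tendsto (quotient (G i)) (D i) (at_right 0)"
      "ivl_tendsto (quotient (G k)) (D k) (at_right 0)"
      by (rule quotient_tendsto, fact in_A)+
    show "\<forall>\<^sub>F \<delta> in at_right 0. Fin (quotient (G i) \<delta>) \<preceq> Fin (quotient (G k) \<delta>) \<or>
        Fin (quotient (G k) \<delta>) \<preceq> Fin (quotient (G i) \<delta>)"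
      using eventually_on_ray
    proof eventually_elim
      case (elim \<delta>)
      then have fin: "is_Fin (G i (y + \<delta> *\<^sub>R h))" "is_Fin (G k (y + \<delta> *\<^sub>R h))" and "0 < \<delta>"
        using in_A by blast+
      from elim G_comparable in_A
      have "G i (y + \<delta> *\<^sub>R h) \<preceq> G k (y + \<delta> *\<^sub>R h) \<or> G k (y + \<delta> *\<^sub>R h) \<preceq> G i (y + \<delta> *\<^sub>R h)"
        by blast
      then show ?case
        unfolding base using gH_quotient_mono fin \<open>0 < \<delta>\<close> by blast
    qed
  qed simp
  then show ?thesis
    unfolding comparable_ivls_def by blast
qed

lemma has_gH_dir_deriv_Gmax:
  assumes j: "j \<in> active" and max: "\<And>i. i \<in> active \<Longrightarrow> Fin (D i) \<preceq> Fin (D j)"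
  shows "has_gH_dir_deriv S Gmax y h (D j)"
  unfolding has_gH_dir_deriv_def
proof (intro conjI)
  have "j \<in> A" and base: "G j y = Gmax y" using j by (auto simp: active_def)
  show "y \<in> S" by (rule base_in)
  show "is_Fin (Gmax y)" using base_finite [OF \<open>j \<in> A\<close>] base by simp
  show "\<forall>\<^sub>F \<delta> in at_right 0. y + \<delta> *\<^sub>R h \<in> S \<and> is_Fin (Gmax (y + \<delta> *\<^sub>R h))"
    using eventually_on_ray by eventually_elim (metis Gmax_attained)
  show "ivl_tendsto (quotient Gmax) (D j) (at_right 0)"
  proof (rule ivl_tendsto_chain_max [where I = active and j = j and l = D and u = "\<lambda>i. quotient (G i)"])
    show "\<And>i. i \<in> active \<Longrightarrow> ivl_tendsto (quotient (G i)) (D i) (at_right 0)"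
      using active_subset quotient_tendsto by blast
    show "finite active" "j \<in> active" "\<And>i. i \<in> active \<Longrightarrow> Fin (D i) \<preceq> Fin (D j)"
      by (fact finite_active j max)+
    show "\<forall>\<^sub>F \<delta> in at_right 0. (\<exists>i\<in>active. quotient Gmax \<delta> = quotient (G i) \<delta>) \<and>
        Fin (quotient (G j) \<delta>) \<preceq> Fin (quotient Gmax \<delta>)"
      using eventually_on_ray eventually_max_is_active
    proof eventually_elim
      case (elim \<delta>)
      then obtain i where i: "i \<in> active" "Gmax (y + \<delta> *\<^sub>R h) = G i (y + \<delta> *\<^sub>R h)"
        by blast
      then have "i \<in> A" "G i y = Gmax y" by (auto simp: active_def)
      then have "quotient Gmax \<delta> = quotient (G i) \<delta>" using i by simp
      moreover have "G j (y + \<delta> *\<^sub>R h) \<preceq> Gmax (y + \<delta> *\<^sub>R h)"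
        using Gmax_upper \<open>j \<in> A\<close> elim by blast
      then have "Fin (quotient (G j) \<delta>) \<preceq> Fin (quotient Gmax \<delta>)"
        unfolding base using elim i \<open>i \<in> A\<close> \<open>j \<in> A\<close> by (intro gH_quotient_mono) auto
      ultimately show ?case using i by blast
    qed
  qed
qed

theorem gH_dir_deriv_Gmax:
  "gH_dir_differentiable S Gmax y h"
  "Fin (gH_dir_deriv S Gmax y h) = ivl_max {Fin (D i) | i. i \<in> active}"
proof -
  let ?D = "{Fin (D i) | i. i \<in> active}"
  have "finite ?D" "?D \<noteq> {}"
    using finite_active active_nonempty by auto
  from finite_chain_has_max [OF this active_derivs_comparable]
  obtain j where j: "j \<in> active" "\<And>i. i \<in> active \<Longrightarrow> Fin (D i) \<preceq> Fin (D j)"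
    by blast
  note deriv = has_gH_dir_deriv_Gmax [OF j]
  show "gH_dir_differentiable S Gmax y h"
    using deriv by (auto simp: gH_dir_differentiable_def)
  have "ivl_max ?D = Fin (D j)"
    by (rule ivl_max_eqI) (use j in blast)+
  then show "Fin (gH_dir_deriv S Gmax y h) = ivl_max ?D"
    using gH_dir_deriv_eqI [OF deriv] by simp
qed

end

theorem theorem3p6:
  fixes Y :: "(real ^ 'n) set"
    and A :: "'i set"
    and G :: "'i \<Rightarrow> real ^ 'n \<Rightarrow> ext_ivl"
    and Gmax :: "real ^ 'n \<Rightarrow> ext_ivl"
    and ybar d :: "real ^ 'n"
  assumes "Y \<noteq> {}" and "convex Y"
    and "finite A" and "A \<noteq> {}"
    and "\<And>i. i \<in> A \<Longrightarrow> ivf_convex_on Y (G i)"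
    and "\<And>i. i \<in> A \<Longrightarrow> gH_continuous_on Y (G i)"
    and "\<And>i y h. i \<in> A \<Longrightarrow> y \<in> Y \<Longrightarrow> h \<in> Y \<Longrightarrow> gH_dir_differentiable Y (G i) y h"
    and "\<And>y. y \<in> Y \<Longrightarrow> comparable_ivls {G i y | i. i \<in> A}"
    and "\<And>y. y \<in> Y \<Longrightarrow> Gmax y = ivl_max {G i y | i. i \<in> A}"
    and "ybar \<in> Y" and "d \<in> Y"
  shows "let I = {i \<in> A. G i ybar = Gmax ybar};
             D = {Fin (gH_dir_deriv Y (G i) ybar d) | i. i \<in> I}
         in gH_dir_differentiable Y Gmax ybar d \<and> comparable_ivls D \<and>
            Fin (gH_dir_deriv Y Gmax ybar d) = ivl_max D"
proof -
  interpret comparable_family Y A G Gmax ybar d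
    by (rule comparable_family.intro) (rule assms | assumption)+
  show ?thesis
    unfolding Let_def active_def [symmetric]
    using gH_dir_deriv_Gmax active_derivs_comparable by blast
qed

end
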